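(* Let $\mathbf{F}:\mathbb{R}^N\to\mathbb{R}^N$ be of class $C^r$ ($r\ge1$) on a neighbourhood of $0$, and consider the system $\mathbf{x}\mapsto\mathbf{F}(\mathbf{x})$. Let $\mathbf{x}_0=0$ be a fixed point, and let $S(X_1)=(X_n)_{n\in\mathbb{N}}$ be an orbit of the system with initial point $X_1$ and $X_n\to0$. If there exists $k\in\{1,\dots,N\}$ such that $\dim_{P_k}S(X_1)>0$, then $\mathbf{x}_0$ is a nonhyperbolic fixed point.
   Context: A fixed point is hyperbolic if no eigenvalue of the Jacobi matrix there has modulus $1$, and nonhyperbolic otherwise. An orbit is $X_{n+1}=\mathbf{F}(X_n)$, identified with its set of points. Projective box dimension: for $k=1,\dots,N$ let $P_k:\mathbb{R}^N\to\mathbb{R}^N$, $P_k(x_1,\dots,x_N)=(0,\dots,0,x_k,0,\dots,0)$, be the projection to the $k$-th coordinate axis; then $\dim_{P_k}S(X_1)=\dim_BP_k(S(X_1))$. Box dimension: for a bounded set $A\subset\mathbb{R}^N$ let $A_\varepsilon=\{y\in\mathbb{R}^N: d(y,A)<\varepsilon\}$ and let $|A_\varepsilon|$ be its Lebesgue measure. For $s\ge 0$ put $\mathcal{M}_*^s(A)=\liminf_{\varepsilon\to0}|A_\varepsilon|/\varepsilon^{N-s}$ and $\mathcal{M}^{*s}(A)=\limsup_{\varepsilon\to0}|A_\varepsilon|/\varepsilon^{N-s}$. The lower and upper box dimensions are $\underline{\dim}_B A=\inf\{s>0:\mathcal{M}_*^s(A)=0\}$ and $\overline{\dim}_B A=\inf\{s>0:\mathcal{M}^{*s}(A)=0\}$;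 if they coincide, the common value is denoted $\dim_B A$. *)

theory Defs
  imports "HOL-Analysis.Analysis"
begin

(* To be used for open U.  In finite dimension, having continuous directional
   derivatives in every fixed direction v, up to order r, is the usual class C^r. *)
primrec C_class_on :: "nat \<Rightarrow> 'a::euclidean_space set \<Rightarrow> ('a \<Rightarrow> 'b::euclidean_space) \<Rightarrow> bool"
where
  "C_class_on 0 U f \<longleftrightarrow> continuous_on U f"
| "C_class_on (Suc r) U f \<longleftrightarrow>
     (\<forall>x\<in>U. f differentiable (at x)) \<and>
     (\<forall>v. C_class_on r U (\<lambda>x. frechet_derivative f (at x) v))"

definition complex_eigenvalue :: "real^'n^'n \<Rightarrow> complex \<Rightarrow> bool" where
  "complex_eigenvalue A z \<longleftrightarrow>
     (\<exists>v::complex^'n. v \<noteq> 0 \<and> map_matrix complex_of_real A *v v = z *s v)"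

definition hyperbolic_fixed_point :: "(real^'n \<Rightarrow> real^'n) \<Rightarrow> real^'n \<Rightarrow> bool" where
  "hyperbolic_fixed_point F p \<longleftrightarrow>
     F p = p \<and> (\<forall>z. complex_eigenvalue (jacobian F (at p)) z \<longrightarrow> cmod z \<noteq> 1)"

definition nonhyperbolic_fixed_point :: "(real^'n \<Rightarrow> real^'n) \<Rightarrow> real^'n \<Rightarrow> bool" where
  "nonhyperbolic_fixed_point F p \<longleftrightarrow> F p = p \<and> \<not> hyperbolic_fixed_point F p"

(* The definitions below are meant for nonempty bounded sets A: infdist returns 0
   when A is empty, and boundedness makes the sets of exponents s in the two
   infima nonempty (every s > DIM('a) belongs to them). *)

definition eps_nbhd :: "real \<Rightarrow> 'a::euclidean_space set \<Rightarrow> 'a set" where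
  "eps_nbhd e A = {y. infdist y A < e}"

definition lower_Minkowski_content :: "real \<Rightarrow> 'a::euclidean_space set \<Rightarrow> ennreal" where
  "lower_Minkowski_content s A =
     Liminf (at_right 0)
       (\<lambda>e. emeasure lebesgue (eps_nbhd e A) / ennreal (e powr (real DIM('a) - s)))"

definition upper_Minkowski_content :: "real \<Rightarrow> 'a::euclidean_space set \<Rightarrow> ennreal" where
  "upper_Minkowski_content s A =
     Limsup (at_right 0)
       (\<lambda>e. emeasure lebesgue (eps_nbhd e A) / ennreal (e powr (real DIM('a) - s)))"

definition lower_box_dim :: "'a::euclidean_space set \<Rightarrow> real" where
  "lower_box_dim A = Inf {s. s > 0 \<and> lower_Minkowski_content s A = 0}"

definition upper_box_dim :: "'a::euclidean_space set \<Rightarrow> real" where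
  "upper_box_dim A = Inf {s. s > 0 \<and> upper_Minkowski_content s A = 0}"

(* The box dimension need not exist, so it is a relation rather than a function. *)
definition has_box_dim :: "'a::euclidean_space set \<Rightarrow> real \<Rightarrow> bool" where
  "has_box_dim A d \<longleftrightarrow> lower_box_dim A = d \<and> upper_box_dim A = d"

definition axis_proj :: "'n \<Rightarrow> real^'n \<Rightarrow> real^'n" where
  "axis_proj k x = axis k (x $ k)"

definition has_proj_box_dim :: "'n \<Rightarrow> (real^'n) set \<Rightarrow> real \<Rightarrow> bool" where
  "has_proj_box_dim k S d \<longleftrightarrow> has_box_dim (axis_proj k ` S) d"

end

theory Submission
  imports Defs "HOL-Computational_Algebra.Fundamental_Theorem_Algebra" "HOL-Real_Asymp.Real_Asymp"
begin

text \<open>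
  An orbit converging to a hyperbolic fixed point does so exponentially fast, and then each
  projection of it has box dimension 0: all but \<open>O(ln (1/e))\<close> of its points lie within distance
  \<open>e\<close> of 0, so the \<open>e\<close>-neighbourhood has volume \<open>O(e ^ N * ln (1/e))\<close>.

  For the exponential rate, let \<open>u\<close> and \<open>s\<close> be seminorms measuring the components of a vector along
  eigenvalues of modulus greater and less than 1. If \<open>s < u\<close> held once close to the fixed point, it
  would persist and \<open>u\<close> would not decrease along the orbit, which is impossible; so \<open>u \<le> s\<close>
  eventually, and then \<open>s\<close> contracts. The seminorms come from the partial products of an
  annihilating product of factors \<open>A - l\<close> over eigenvalues \<open>l\<close>; no invariant splitting is needed.
\<close>

section \<open>Polynomials and products of linear factors in a complex matrix\<close>

text \<open>This is \<open>p(A) v\<close>; iterating the action on \<open>v\<close> avoids forming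
  powers of the matrix.\<close>

definition poly_mv :: "complex^'n^'n \<Rightarrow> complex poly \<Rightarrow> complex^'n \<Rightarrow> complex^'n" where
  "poly_mv A p v = (\<Sum>i\<le>degree p. coeff p i *s (((*v) A ^^ i) v))"

lemma poly_mv_altdef:
  assumes "degree p \<le> n"
  shows "poly_mv A p v = (\<Sum>i\<le>n. coeff p i *s (((*v) A ^^ i) v))"
  unfolding poly_mv_def using assms
  by (intro sum.mono_neutral_left) (auto simp: coeff_eq_0)

lemma matrix_power_mv_diff:
  fixes A :: "complex^'n^'n"
  shows "((*v) A ^^ i) (v - c *s w) = ((*v) A ^^ i) v - c *s ((*v) A ^^ i) w"
  by (induction i) (simp_all add: matrix_vector_mult_diff_distrib vector_scalar_commute)

text \<open>Splits off one root: the factor \<open>A - a\<close> is moved onto the vector, which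
  lowers the degree in the later induction.\<close>

lemma poly_mv_linear_factor:
  "poly_mv A ([:-a, 1:] * q) v = poly_mv A q (A *v v - a *s v)"
proof -
  have deg: "degree ([:-a, 1:] * q) \<le> Suc (degree q)"
    by (metis degree_mult_le degree_pCons_eq_if degree_1 one_neq_zero plus_1_eq_Suc One_nat_def one_pCons pCons_eq_0_iff)
  have "poly_mv A ([:-a, 1:] * q) v
      = (\<Sum>i\<le>Suc (degree q). (coeff (pCons 0 q) i - a * coeff q i) *s ((*v) A ^^ i) v)"
    by (subst poly_mv_altdef[OF deg]) simp
  also have "\<dots> = (\<Sum>i\<le>Suc (degree q). coeff (pCons 0 q) i *s ((*v) A ^^ i) v)
      - (\<Sum>i\<le>Suc (degree q). (a * coeff q i) *s ((*v) A ^^ i) v)"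
    by (simp only: vec.scale_left_diff_distrib sum_subtractf)
  also have "(\<Sum>i\<le>Suc (degree q). coeff (pCons 0 q) i *s ((*v) A ^^ i) v)
      = (\<Sum>i\<le>degree q. coeff q i *s ((*v) A ^^ i) (A *v v))"
    by (subst sum.atMost_Suc_shift) (simp add: funpow_swap1)
  also have "(\<Sum>i\<le>Suc (degree q). (a * coeff q i) *s ((*v) A ^^ i) v)
      = (\<Sum>i\<le>degree q. (a * coeff q i) *s ((*v) A ^^ i) v)"
    by (simp add: coeff_eq_0)
  also have "(\<Sum>i\<le>degree q. coeff q i *s ((*v) A ^^ i) (A *v v)) - \<dots>
      = poly_mv A q (A *v v - a *s v)"
    by (simp add: poly_mv_def matrix_power_mv_diff vec.scale_right_diff_distrib sum_subtractf mult.commute)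
  finally show ?thesis .
qed

text \<open>In dimension \<open>M\<close>, the \<open>M + 1\<close> iterates of \<open>v\<close>
  from index 0 to \<open>M\<close> must satisfy a nontrivial linear relation, whose coefficients
  form the polynomial.\<close>

lemma annihilating_poly_exists:
  fixes A :: "complex^'n^'n"
  shows "\<exists>p. p \<noteq> 0 \<and> poly_mv A p v = 0"
proof -
  define f where "f = (\<lambda>i. ((*v) A ^^ i) v)"
  \<comment> \<open>The dimension here is the real one, twice the complex one. A relation with real
    coefficients is also a complex one, and the larger degree is harmless.\<close>
  define M where "M = DIM(complex^'n)"
  have "\<exists>c::nat \<Rightarrow> complex. (\<exists>i\<le>M. c i \<noteq> 0) \<and> (\<Sum>i\<le>M. c i *s f i) = 0"
  \<comment> \<open>\<open>dependent\<close> speaks of sets and so does not see repetitions; two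
    equal iterates are treated apart, with the relation \<open>f i - f j = 0\<close>.\<close>
  proof (cases "inj_on f {..M}")
    case True
    then have "card (f ` {..M}) > DIM(complex^'n)"
      by (simp add: card_image M_def)
    then have "dependent (f ` {..M})"
      by (intro dependent_biggerset) auto
    then obtain u where u: "\<exists>w\<in>f ` {..M}. u w \<noteq> 0" "(\<Sum>w\<in>f ` {..M}. u w *\<^sub>R w) = 0"
      by (auto simp: dependent_finite)
    have "(\<Sum>i\<le>M. u (f i) *\<^sub>R f i) = 0"
      using u(2) sum.reindex[OF True, of "\<lambda>w. u w *\<^sub>R w"] by simp
    moreover have "u (f i) *\<^sub>R f i = complex_of_real (u (f i)) *s f i" for i
      by (simp add: vec_eq_iff scaleR_conv_of_real[of _ "_ :: complex"])
    ultimately show ?thesis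
      using u(1) by (intro exI[of _ "\<lambda>i. complex_of_real (u (f i))"]) auto
  next
    case False
    then obtain i j where ij: "i \<le> M" "j \<le> M" "i \<noteq> j" "f i = f j"
      by (auto simp: inj_on_def)
    define c :: "nat \<Rightarrow> complex" where "c = (\<lambda>k. if k = i then 1 else if k = j then -1 else 0)"
    have "(\<Sum>k\<le>M. c k *s f k) = (\<Sum>k\<in>{i, j}. c k *s f k)"
      using ij by (intro sum.mono_neutral_right) (auto simp: c_def)
    also have "\<dots> = 0"
      using ij by (simp add: c_def)
    finally show ?thesis
      using ij by (intro exI[of _ c]) (auto simp: c_def)
  qed
  then obtain c where c: "\<exists>i\<le>M. c i \<noteq> 0" "(\<Sum>i\<le>M. c i *s f i) = 0"
    by blast
  define p where "p = (\<Sum>i\<le>M. monom (c i) i)"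
  have coeff_p: "coeff p i = (if i \<le> M then c i else 0)" for i
    by (simp add: p_def coeff_sum)
  have "degree p \<le> M"
    by (rule degree_le) (simp add: coeff_p)
  then have "poly_mv A p v = 0"
    using c(2) by (simp add: poly_mv_altdef coeff_p f_def)
  moreover have "p \<noteq> 0"
    using c(1) coeff_p by (metis coeff_0)
  ultimately show ?thesis by blast
qed

text \<open>The product of the commuting factors \<open>A - l\<close>, the head acting first.
  Keeping the roots in a list gives access to partial products.\<close>

definition linear_factors :: "complex^'n^'n \<Rightarrow> complex list \<Rightarrow> complex^'n \<Rightarrow> complex^'n" where
  "linear_factors A = fold (\<lambda>l w. A *v w - l *s w)"

lemma linear_factors_Nil [simp]: "linear_factors A [] v = v"
  and linear_factors_Cons [simp]:
    "linear_factors A (l # ls) v = linear_factors A ls (A *v v - l *s v)"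
  and linear_factors_append:
    "linear_factors A (ls @ ms) v = linear_factors A ms (linear_factors A ls v)"
  by (simp_all add: linear_factors_def)

lemma linear_factors_diff:
  "linear_factors A ls (v - w) = linear_factors A ls v - linear_factors A ls w"
proof (induction ls arbitrary: v w)
  case (Cons l ls)
  have "A *v (v - w) - l *s (v - w) = (A *v v - l *s v) - (A *v w - l *s w)"
    by (simp add: matrix_vector_mult_diff_distrib vec.scale_right_diff_distrib)
  then show ?case using Cons by (simp only: linear_factors_Cons)
qed simp

lemma linear_factors_scale: "linear_factors A ls (c *s v) = c *s linear_factors A ls v"
proof (induction ls arbitrary: v)
  case (Cons l ls)
  have "A *v (c *s v) - l *s (c *s v) = c *s (A *v v - l *s v)"
    by (simp add: vector_scalar_commute vec.scale_right_diff_distrib mult.commute)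
  then show ?case using Cons by (simp only: linear_factors_Cons)
qed simp

lemma linear_factors_0 [simp]: "linear_factors A ls 0 = 0"
  using linear_factors_diff[of A ls 0 0] by simp

lemma linear_factors_add:
  "linear_factors A ls (v + w) = linear_factors A ls v + linear_factors A ls w"
  using linear_factors_diff[of A ls "v + w" w] by simp

lemma linear_factors_matrix_commute:
  "linear_factors A ls (A *v v) = A *v linear_factors A ls v"
proof (induction ls arbitrary: v)
  case (Cons l ls)
  have "A *v (A *v v) - l *s (A *v v) = A *v (A *v v - l *s v)"
    by (simp add: matrix_vector_mult_diff_distrib vector_scalar_commute)
  then show ?case using Cons by (simp only: linear_factors_Cons)
qed simp

lemma linear_factors_commute:
  "linear_factors A ls (linear_factors A ms v) = linear_factors A ms (linear_factors A ls v)"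
  by (induction ms arbitrary: v)
     (simp_all add: linear_factors_diff linear_factors_scale linear_factors_matrix_commute)

text \<open>Induction on the degree, splitting off a root \<open>a\<close>. If \<open>a\<close> is
  an eigenvalue it joins the list; otherwise \<open>A - a\<close> is injective and, as the factors
  commute, can be cancelled.\<close>

lemma linear_factors_annihilate_vector:
  assumes "p \<noteq> 0" "poly_mv A p v = 0"
  shows "\<exists>ls. (\<forall>l\<in>set ls. \<exists>w. w \<noteq> 0 \<and> A *v w = l *s w) \<and> linear_factors A ls v = 0"
  using assms
proof (induction "degree p" arbitrary: p v)
  case 0
  then obtain a where "p = [:a:]" "a \<noteq> 0"
    by (metis degree_eq_zeroE pCons_0_0)
  then have "v = 0"
    using 0 by (simp add: poly_mv_def)
  then show ?case
    by (intro exI[of _ "[]"]) simp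
next
  case (Suc n)
  then obtain a where "poly p a = 0"
    by (metis fundamental_theorem_of_algebra constant_degree nat.distinct(1))
  then obtain q where p: "p = [:-a, 1:] * q"
    by (auto simp: poly_eq_0_iff_dvd)
  have "q \<noteq> 0" using Suc.prems p by auto
  then have "degree p = Suc (degree q)"
    unfolding p by (subst degree_mult_eq) auto
  moreover have "poly_mv A q (A *v v - a *s v) = 0"
    using Suc.prems by (simp only: p poly_mv_linear_factor)
  ultimately obtain ls where ls: "\<forall>l\<in>set ls. \<exists>w. w \<noteq> 0 \<and> A *v w = l *s w"
    "linear_factors A ls (A *v v - a *s v) = 0"
    using Suc.hyps \<open>q \<noteq> 0\<close> by (metis Suc_inject)
  show ?case
  proof (cases "\<exists>w. w \<noteq> 0 \<and> A *v w = a *s w")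
    case True
    then show ?thesis using ls by (intro exI[of _ "a # ls"]) simp
  next
    case False
    have "A *v linear_factors A ls v = a *s linear_factors A ls v"
      using ls(2) by (simp add: linear_factors_diff linear_factors_scale linear_factors_matrix_commute)
    then show ?thesis using ls(1) False by blast
  qed
qed

text \<open>Concatenating lists that annihilate the single basis vectors gives one list for all of
  them, since the factors commute. Eigenvalues may be repeated.\<close>

lemma eigenvalue_factors_annihilate:
  fixes A :: "complex^'n^'n"
  shows "\<exists>ls. (\<forall>l\<in>set ls. \<exists>w. w \<noteq> 0 \<and> A *v w = l *s w) \<and> (\<forall>v. linear_factors A ls v = 0)"
proof -
  have "\<exists>ls. (\<forall>l\<in>set ls. \<exists>w. w \<noteq> 0 \<and> A *v w = l *s w) \<and> (\<forall>k\<in>K. linear_factors A ls (axis k 1) = 0)"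
    if "finite K" for K :: "'n set"
    using that
  proof (induction K rule: finite_induct)
    case empty
    show ?case by (intro exI[of _ "[]"]) simp
  next
    case (insert k K)
    then obtain ls where ls: "\<forall>l\<in>set ls. \<exists>w. w \<noteq> 0 \<and> A *v w = l *s w"
      "\<forall>k\<in>K. linear_factors A ls (axis k 1) = 0" by blast
    obtain ms where ms: "\<forall>l\<in>set ms. \<exists>w. w \<noteq> 0 \<and> A *v w = l *s w"
      "linear_factors A ms (axis k 1) = 0"
      using annihilating_poly_exists linear_factors_annihilate_vector by blast
    have "linear_factors A (ls @ ms) (axis k 1) = 0"
      by (simp add: linear_factors_append linear_factors_commute[of A ms ls] ms)
    moreover have "\<forall>k\<in>K. linear_factors A (ls @ ms) (axis k 1) = 0"
      by (simp add: linear_factors_append ls)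
    ultimately show ?case
      using ls(1) ms(1) by (intro exI[of _ "ls @ ms"]) auto
  qed
  from this[of UNIV] obtain ls where ls: "\<forall>l\<in>set ls. \<exists>w. w \<noteq> 0 \<and> A *v w = l *s w"
    "\<And>k. linear_factors A ls (axis k 1) = 0" by auto
  have "linear_factors A ls v = 0" for v
  proof -
    have sum: "linear_factors A ls (\<Sum>k\<in>K. g k) = (\<Sum>k\<in>K. linear_factors A ls (g k))"
      if "finite K" for K :: "'n set" and g
      using that by (induction K rule: finite_induct) (simp_all add: linear_factors_add)
    have "linear_factors A ls v = linear_factors A ls (\<Sum>k\<in>UNIV. v $ k *s axis k 1)"
      by (simp add: basis_expansion)
    also have "\<dots> = 0"
      by (subst sum) (simp_all add: linear_factors_scale ls)
    finally show ?thesis .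
  qed
  with ls show ?thesis by blast
qed

section \<open>Box dimension of exponentially decaying sequences\<close>

text \<open>Covering the first \<open>O(ln (1/e))\<close> points by one ball each and the tail by
  one more bounds the Minkowski quotient by \<open>O(e powr s * ln (1/e))\<close>, which tends to 0
  for every \<open>s > 0\<close>.\<close>

lemma exponential_imp_upper_box_dim_0:
  fixes b :: "nat \<Rightarrow> 'a::euclidean_space"
  assumes r: "0 < r" "r < 1" and b: "\<And>n. norm (b n) \<le> C * r ^ n"
  shows "upper_box_dim (range b) = 0"
proof -
  \<comment> \<open>With \<open>D\<close> at least 1, \<open>ln (D / e)\<close> is nonnegative for
    all \<open>e < 1\<close>.\<close>
  define D where "D = max C 1"
  have D: "D \<ge> 1" "\<And>n. norm (b n) \<le> D * r ^ n"
  proof -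
    fix n
    have "C * r ^ n \<le> D * r ^ n"
      using r by (intro mult_right_mono) (auto simp: D_def)
    then show "norm (b n) \<le> D * r ^ n" using b[of n] by linarith
  qed (simp add: D_def)
  define L where "L = ln (1 / r)"
  have L: "L > 0" using r by (simp add: L_def)
  define c where "c = unit_ball_vol (real DIM('a)) * 2 ^ DIM('a)"
  have c: "c \<ge> 0" by (simp add: c_def)
  have vol: "emeasure lebesgue (eps_nbhd e (range b))
      \<le> ennreal ((ln (D / e) / L + 2) * c * e ^ DIM('a))" if e: "0 < e" "e < 1" for e
  proof -
    \<comment> \<open>The least index with \<open>D * r ^ n \<le> e\<close>, because
      \<open>r ^ n = exp (- n * L)\<close>.\<close>
    define n where "n = nat \<lceil>ln (D / e) / L\<rceil>"
    have lnpos: "ln (D / e) \<ge> 0" using D(1) e by simp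
    have n: "real n \<le> ln (D / e) / L + 1" "ln (D / e) / L \<le> real n"
      using lnpos L unfolding n_def by (auto simp: of_nat_nat real_nat_ceiling_ge)
    have small: "norm (b i) \<le> e" if "i \<ge> n" for i
    proof -
      have "ln (D / e) \<le> real i * L"
        using n(2) L that by (simp add: field_simps) (meson L dual_order.trans mult_left_mono less_imp_le of_nat_mono)
      then have "D / e \<le> exp (real i * L)"
        using D(1) e by (metis divide_pos_pos exp_le_cancel_iff exp_ln less_le_trans zero_less_one)
      also have "\<dots> = (1 / r) ^ i"
        using r by (simp add: L_def exp_of_nat_mult)
      finally have "D * r ^ i \<le> e"
        using e r by (simp add: field_simps)
      then show ?thesis using D(2)[of i] by linarith
    qed
    \<comment> \<open>Radius \<open>2 * e\<close> is for the tail: its points are within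
      \<open>e\<close> of 0, and the neighbourhood adds less than \<open>e\<close>. The
      \<open>n + 1\<close> balls account for the summand 2 in the volume bound, one unit coming from
      the rounding in \<open>n\<close>.\<close>
    define B where "B = (\<Union>i<n. ball (b i) (2 * e)) \<union> ball 0 (2 * e)"
    have sub: "eps_nbhd e (range b) \<subseteq> B"
    proof
      fix y assume "y \<in> eps_nbhd e (range b)"
      then have "infdist y (range b) < e" by (simp add: eps_nbhd_def)
      then obtain i where i: "dist y (b i) < e"
        by (auto simp: infdist_def cINF_less_iff)
      show "y \<in> B"
      proof (cases "i < n")
        case True
        then show ?thesis using i e by (force simp: B_def dist_commute)
      next
        case False
        then have "dist y 0 < 2 * e"
          using small[of i] i dist_triangle[of y 0 "b i"] by simp
        then show ?thesis by (simp add: B_def dist_commute)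
      qed
    qed
    have ball: "emeasure lborel (ball x (2 * e)) = ennreal (c * e ^ DIM('a))" for x :: 'a
      using e by (simp add: emeasure_ball c_def power_mult_distrib mult.assoc)
    have "emeasure lebesgue (eps_nbhd e (range b)) \<le> emeasure lebesgue B"
      using sub by (intro emeasure_mono) (auto simp: B_def)
    also have "\<dots> = emeasure lborel B"
      by (simp add: B_def)
    also have "\<dots> \<le> emeasure lborel (\<Union>i<n. ball (b i) (2 * e)) + emeasure lborel (ball (0::'a) (2 * e))"
      unfolding B_def by (intro emeasure_subadditive) auto
    also have "emeasure lborel (\<Union>i<n. ball (b i) (2 * e)) \<le> (\<Sum>i<n. emeasure lborel (ball (b i) (2 * e)))"
      by (intro emeasure_subadditive_finite) auto
    also have "(\<Sum>i<n. emeasure lborel (ball (b i) (2 * e))) + emeasure lborel (ball (0::'a) (2 * e))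
        = ennreal (real n * (c * e ^ DIM('a)) + c * e ^ DIM('a))"
      using c e by (simp add: ball ennreal_plus ennreal_mult ennreal_of_nat_eq_real_of_nat)
    also have "\<dots> \<le> ennreal ((ln (D / e) / L + 2) * c * e ^ DIM('a))"
    proof (rule ennreal_leI)
      have "(real n + 1) * (c * e ^ DIM('a)) \<le> (ln (D / e) / L + 2) * (c * e ^ DIM('a))"
        using n c e by (intro mult_right_mono) auto
      then show "real n * (c * e ^ DIM('a)) + c * e ^ DIM('a) \<le> (ln (D / e) / L + 2) * c * e ^ DIM('a)"
        by (simp add: algebra_simps)
    qed
    finally show ?thesis by (simp add: add_right_mono)
  qed
  have "upper_Minkowski_content s (range b) = 0" if s: "s > 0" for s
  proof -
    define q where "q = (\<lambda>e. emeasure lebesgue (eps_nbhd e (range b)) / ennreal (e powr (real DIM('a) - s)))"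
    have bound: "q e \<le> ennreal ((ln (D / e) / L + 2) * c * e powr s)" if e: "0 < e" "e < 1" for e
    proof -
      have "q e \<le> ennreal ((ln (D / e) / L + 2) * c * e ^ DIM('a)) / ennreal (e powr (real DIM('a) - s))"
        unfolding q_def by (intro divide_right_mono_ennreal vol e)
      also have "\<dots> = ennreal ((ln (D / e) / L + 2) * c * e ^ DIM('a) / e powr (real DIM('a) - s))"
        using e c L D(1) by (intro divide_ennreal mult_nonneg_nonneg add_nonneg_nonneg divide_nonneg_nonneg) auto
      also have "e ^ DIM('a) / e powr (real DIM('a) - s) = e powr s"
        using e by (simp add: powr_diff powr_realpow)
      then have "(ln (D / e) / L + 2) * c * e ^ DIM('a) / e powr (real DIM('a) - s)
          = (ln (D / e) / L + 2) * c * e powr s"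
        by (metis times_divide_eq_right)
      finally show ?thesis .
    qed
    have "((\<lambda>e. (ln (D / e) / L + 2) * c * e powr s) \<longlongrightarrow> 0) (at_right 0)"
      using s L D(1) by real_asymp
    then have "((\<lambda>e. ennreal ((ln (D / e) / L + 2) * c * e powr s)) \<longlongrightarrow> ennreal 0) (at_right 0)"
      by (rule tendsto_ennrealI)
    moreover have "\<forall>\<^sub>F e in at_right 0. q e \<le> ennreal ((ln (D / e) / L + 2) * c * e powr s)"
      using eventually_at_right_less eventually_at_right_real[of 0 1]
      by (auto elim!: eventually_mono intro: bound)
    ultimately have "(q \<longlongrightarrow> 0) (at_right 0)"
      by (intro tendsto_sandwich[of "\<lambda>_. 0" q _ "\<lambda>e. ennreal ((ln (D / e) / L + 2) * c * e powr s)"]) auto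
    then show ?thesis
      unfolding upper_Minkowski_content_def q_def[symmetric]
      by (intro lim_imp_Limsup) auto
  qed
  then have "{s. s > 0 \<and> upper_Minkowski_content s (range b) = 0} = {0<..}"
    by auto
  then show ?thesis
    by (simp add: upper_box_dim_def)
qed

section \<open>Growth and decay in complementary cones\<close>

text \<open>Where \<open>s \<le> u\<close>, the error term is at most \<open>m / 2 * u\<close>;
  hence \<open>u\<close> grows by a factor \<open>1 + m / 2\<close> and the next \<open>s\<close> is
  at most \<open>(1 - m / 2) * u\<close>, so the cone is invariant. Where \<open>u \<le> s\<close>,
  the same computation contracts \<open>s\<close> by \<open>1 - m / 2\<close>.\<close>

lemma cone_recursion_imp_exponential:
  fixes s u :: "nat \<Rightarrow> real"
  assumes m: "0 < m" "m \<le> 1"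
    and nonneg: "\<And>n. s n \<ge> 0" "\<And>n. u n \<ge> 0"
    and lim: "u \<longlonglongrightarrow> 0"
    and u: "\<And>n. n \<ge> N \<Longrightarrow> u (Suc n) \<ge> (1 + m) * u n - m / 4 * (u n + s n)"
    and s: "\<And>n. n \<ge> N \<Longrightarrow> s (Suc n) \<le> (1 - m) * s n + m / 4 * (u n + s n)"
  shows "\<exists>C. \<forall>n. u n + s n \<le> C * (1 - m / 2) ^ n"
proof -
  define r where "r = 1 - m / 2"
  have r: "0 < r" "r < 1" using m by (auto simp: r_def)
  have us: "u k \<le> s k" if k: "k \<ge> N" for k
  proof (rule ccontr)
    assume "\<not> u k \<le> s k"
    then have pos: "s k < u k" by simp
    \<comment> \<open>The lower bound \<open>u k > 0\<close> is carried along because it contradicts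
      \<open>u\<close> tending to 0.\<close>
    have "s (k + j) \<le> u (k + j) \<and> u k \<le> u (k + j)" for j
    proof (induction j)
      case (Suc j)
      let ?n = "k + j"
      have "m / 4 * (u ?n + s ?n) \<le> m / 4 * (2 * u ?n)"
        using Suc m by (intro mult_left_mono) auto
      moreover have "(1 - m) * s ?n \<le> (1 - m) * u ?n"
        using Suc m by (intro mult_left_mono) auto
      moreover have "0 \<le> m * u ?n" using m nonneg by simp
      ultimately show ?case
        using u[of ?n] s[of ?n] k Suc by (simp add: algebra_simps)
    qed (use pos in simp)
    moreover have "(\<lambda>j. u (k + j)) \<longlonglongrightarrow> 0"
      using lim LIMSEQ_ignore_initial_segment[of u 0 k] by (simp add: add.commute)
    ultimately have "u k \<le> 0"
      by (intro LIMSEQ_le_const[of "\<lambda>j. u (k + j)" 0]) auto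
    then show False using pos nonneg(1)[of k] by linarith
  qed
  have step: "s (Suc n) \<le> r * s n" if "n \<ge> N" for n
  proof -
    have "m / 4 * (u n + s n) \<le> m / 4 * (2 * s n)"
      using us[OF that] m by (intro mult_left_mono) auto
    then have "s (Suc n) \<le> (1 - m) * s n + m / 4 * (2 * s n)"
      using s[OF that] by linarith
    also have "\<dots> = r * s n" by (simp add: r_def field_simps)
    finally show ?thesis .
  qed
  have tail: "s (N + j) \<le> s N * r ^ j" for j
  proof (induction j)
    case (Suc j)
    have "s (N + Suc j) \<le> r * s (N + j)" using step[of "N + j"] by simp
    also have "\<dots> \<le> r * (s N * r ^ j)" using Suc r by (intro mult_left_mono) auto
    finally show ?case by (simp add: mult_ac)
  qed simp
  \<comment> \<open>A sum of nonnegative terms dominates each of them, which settles the indices up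
    to \<open>N\<close>. The factor 2 serves the tail, where
    \<open>u + s \<le> 2 * s\<close>.\<close>
  define C where "C = (\<Sum>i\<le>N. (2 * s i + u i) / r ^ i)"
  have nn: "0 \<le> (2 * s i + u i) / r ^ i" for i using nonneg r by simp
  have C: "(2 * s i + u i) / r ^ i \<le> C" if "i \<le> N" for i
    unfolding C_def using that nn by (intro member_le_sum) auto
  have "u n + s n \<le> C * r ^ n" for n
  proof (cases "n \<le> N")
    case True
    then have "2 * s n + u n \<le> C * r ^ n"
      using C[of n] r by (simp add: divide_le_eq)
    then show ?thesis using nonneg(1)[of n] by linarith
  next
    case False
    then obtain j where n: "n = N + j" using le_Suc_ex nat_le_linear by blast
    have "u n + s n \<le> 2 * (s N * r ^ j)"
      using us[of n] tail[of j] n by simp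
    also have "\<dots> = (2 * s N) / r ^ N * r ^ n"
      using r by (simp add: n power_add)
    also have "\<dots> \<le> C * r ^ n"
    proof (rule mult_right_mono)
      have "2 * s N / r ^ N \<le> (2 * s N + u N) / r ^ N"
        using nonneg r by (intro divide_right_mono) auto
      then show "2 * s N / r ^ N \<le> C" using C[of N] by simp
    qed (use r in simp)
    finally show ?thesis .
  qed
  then show ?thesis unfolding r_def by blast
qed

section \<open>Complexification and seminorms adapted to a hyperbolic matrix\<close>

definition complexify :: "real^'n \<Rightarrow> complex^'n" where
  "complexify x = (\<chi> i. complex_of_real (x $ i))"

lemma complexify_add: "complexify (x + y) = complexify x + complexify y"
  by (simp add: complexify_def vec_eq_iff)

lemma complexify_scaleR: "complexify (c *\<^sub>R x) = complex_of_real c *s complexify x"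
  by (simp add: complexify_def vec_eq_iff)

lemma complexify_matrix:
  "complexify (A *v x) = map_matrix complex_of_real A *v complexify x"
  by (simp add: complexify_def vec_eq_iff matrix_vector_mult_def map_matrix_def)

lemma norm_complexify: "norm (complexify x) = norm x"
  by (simp add: complexify_def norm_vec_def)

lemma norm_vector_smult:
  fixes w :: "complex^'n"
  shows "norm (c *s w) = cmod c * norm w"
  by (simp add: norm_vec_def norm_mult L2_set_right_distrib)

text \<open>
  The coordinates \<open>Y i x\<close> below satisfy \<open>Y i (A x) = l i * Y i x + Y (i + 1) x\<close>, a block Jordan form
  in which the weights \<open>t ^ i\<close> make the off-diagonal part as small as desired.
\<close>
lemma hyperbolic_matrix_seminorms:
  fixes A :: "real^'n^'n"
  assumes hyp: "\<And>z. complex_eigenvalue A z \<Longrightarrow> cmod z \<noteq> 1"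
  obtains m K and s u :: "real^'n \<Rightarrow> real" where
    "0 < m" "m \<le> 1" "0 < K"
    "\<And>x. 0 \<le> s x" "\<And>x. 0 \<le> u x"
    "\<And>x y. s (x + y) \<le> s x + s y" "\<And>x y. u (x + y) \<le> u x + u y"
    "\<And>x. norm x \<le> u x + s x" "\<And>x. u x + s x \<le> K * norm x"
    "\<And>x. (1 + m) * u x - m / 8 * (u x + s x) \<le> u (A *v x)"
    "\<And>x. s (A *v x) \<le> (1 - m) * s x + m / 8 * (u x + s x)"
proof -
  define B where "B = map_matrix complex_of_real A"
  obtain ls where ls: "\<forall>l\<in>set ls. \<exists>w. w \<noteq> 0 \<and> B *v w = l *s w" "\<And>v. linear_factors B ls v = 0"
    using eigenvalue_factors_annihilate by blast
  define n where "n = length ls"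
  have ne1: "cmod l \<noteq> 1" if "l \<in> set ls" for l
    using ls(1) that hyp[of l] by (auto simp: complex_eigenvalue_def B_def)
  \<comment> \<open>The distance of the listed eigenvalues from the unit circle, capped at 1 so that
    \<open>1 - m\<close> stays nonnegative.\<close>
  define m where "m = Min (insert 1 ((\<lambda>l. \<bar>cmod l - 1\<bar>) ` set ls))"
  have m: "0 < m" "m \<le> 1"
    using ne1 by (auto simp: m_def)
  have gap: "m \<le> \<bar>cmod (ls ! i) - 1\<bar>" if "i < n" for i
    unfolding m_def using that by (intro Min_le) (auto simp: n_def)
  \<comment> \<open>Coordinate \<open>i + 1\<close> carries one more factor \<open>t\<close> than
    coordinate \<open>i\<close>, so the coupling to it is weighted by
    \<open>1 / t = m / 8\<close>.\<close>
  define t where "t = 8 / m"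
  have t: "t > 0" using m by (simp add: t_def)
  \<comment> \<open>\<open>Y 0\<close> is the vector itself and \<open>Y n\<close> vanishes, so the
    recursion closes after \<open>n\<close> steps.\<close>
  define Y where "Y = (\<lambda>i x. linear_factors B (take i ls) (complexify x))"
  have Y_add: "Y i (x + y) = Y i x + Y i y" for i x y
    by (simp add: Y_def complexify_add linear_factors_add)
  have Y_linear: "linear (Y i)" for i
  proof (rule linearI)
    show "Y i (x + y) = Y i x + Y i y" for x y by (rule Y_add)
    fix c x
    have smult: "c *\<^sub>R w = complex_of_real c *s w" for w :: "complex^'n"
      by (simp add: vec_eq_iff scaleR_conv_of_real[of _ "_ :: complex"])
    then show "Y i (c *\<^sub>R x) = c *\<^sub>R Y i x"
      by (simp add: Y_def complexify_scaleR smult linear_factors_scale)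
  qed
  have Y_n: "Y n x = 0" for x
    by (simp add: Y_def n_def ls(2))
  have Y_A: "Y i (A *v x) = ls ! i *s Y i x + Y (Suc i) x" if "i < n" for i x
    using that unfolding n_def
    by (simp add: Y_def complexify_matrix B_def[symmetric] linear_factors_matrix_commute
        take_Suc_conv_app_nth linear_factors_append)
  define g where "g = (\<lambda>i x. t ^ i * norm (Y i x))"
  have g0: "0 \<le> g i x" for i x
    using t by (simp add: g_def)
  have g_add: "g i (x + y) \<le> g i x + g i y" for i x y
  proof -
    have "t ^ i * norm (Y i x + Y i y) \<le> t ^ i * (norm (Y i x) + norm (Y i y))"
      using t by (intro mult_left_mono norm_triangle_ineq) simp
    then show ?thesis by (simp add: g_def Y_add algebra_simps)
  qed
  have g_shift: "t ^ i * norm (Y (Suc i) x) = m / 8 * g (Suc i) x" for i x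
    using m by (simp add: g_def t_def)
  have g_upper: "g i (A *v x) \<le> cmod (ls ! i) * g i x + m / 8 * g (Suc i) x"
    and g_lower: "cmod (ls ! i) * g i x - m / 8 * g (Suc i) x \<le> g i (A *v x)" if "i < n" for i x
  proof -
    have "norm (Y i (A *v x)) \<le> cmod (ls ! i) * norm (Y i x) + norm (Y (Suc i) x)"
      unfolding Y_A[OF that] by (metis norm_triangle_ineq norm_vector_smult)
    then have "t ^ i * norm (Y i (A *v x)) \<le> t ^ i * (cmod (ls ! i) * norm (Y i x) + norm (Y (Suc i) x))"
      using t by (intro mult_left_mono) auto
    then show "g i (A *v x) \<le> cmod (ls ! i) * g i x + m / 8 * g (Suc i) x"
      unfolding g_shift[symmetric] by (simp add: g_def algebra_simps)
    have "cmod (ls ! i) * norm (Y i x) - norm (Y (Suc i) x) \<le> norm (Y i (A *v x))"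
      unfolding Y_A[OF that] by (metis norm_diff_ineq norm_vector_smult)
    then have "t ^ i * (cmod (ls ! i) * norm (Y i x) - norm (Y (Suc i) x)) \<le> t ^ i * norm (Y i (A *v x))"
      using t by (intro mult_left_mono) auto
    then show "cmod (ls ! i) * g i x - m / 8 * g (Suc i) x \<le> g i (A *v x)"
      unfolding g_shift[symmetric] by (simp add: g_def algebra_simps)
  qed
  \<comment> \<open>Positions in the list are classified, not eigenvalues, so repeated eigenvalues
    contribute several coordinates.\<close>
  define S where "S = {i. i < n \<and> cmod (ls ! i) < 1}"
  define U where "U = {i. i < n \<and> cmod (ls ! i) > 1}"
  have fin: "finite S" "finite U" by (auto simp: S_def U_def)
  have sub: "S \<subseteq> {..<n}" "U \<subseteq> {..<n}" by (auto simp: S_def U_def)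
  have SU: "S \<inter> U = {}" "U \<union> S = {..<n}"
  proof -
    have "cmod (ls ! i) < 1 \<or> cmod (ls ! i) > 1" if "i < n" for i
      using ne1[of "ls ! i"] that by (auto simp: n_def)
    then show "S \<inter> U = {}" "U \<union> S = {..<n}"
      by (auto simp: S_def U_def)
  qed
  define s where "s = (\<lambda>x. \<Sum>i\<in>S. g i x)"
  define u where "u = (\<lambda>x. \<Sum>i\<in>U. g i x)"
  have us: "u x + s x = (\<Sum>i<n. g i x)" for x
    unfolding u_def s_def SU(2)[symmetric] using fin SU(1)
    by (subst sum.union_disjoint) auto
  \<comment> \<open>The successor of a position in \<open>S\<close> may lie in \<open>U\<close> and
    conversely, so the coupling is bounded by the full sum \<open>u + s\<close>. The term at
    \<open>n\<close> is zero.\<close>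
  have shift: "(\<Sum>i\<in>I. m / 8 * g (Suc i) x) \<le> m / 8 * (u x + s x)" if "I \<subseteq> {..<n}" for I x
  proof -
    have "(\<Sum>i\<in>I. g (Suc i) x) \<le> (\<Sum>i<n. g (Suc i) x)"
      using that g0 by (intro sum_mono2) auto
    also have "\<dots> \<le> (\<Sum>i<Suc n. g i x)"
      by (simp only: sum.lessThan_Suc_shift) (simp add: g0)
    also have "\<dots> = u x + s x"
      by (simp add: us) (simp add: g_def Y_n)
    finally show ?thesis
      unfolding sum_distrib_left[symmetric] using m by (intro mult_left_mono) auto
  qed
  have s_A: "s (A *v x) \<le> (1 - m) * s x + m / 8 * (u x + s x)" for x
  proof -
    have "s (A *v x) \<le> (\<Sum>i\<in>S. (1 - m) * g i x + m / 8 * g (Suc i) x)"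
      unfolding s_def
    proof (rule sum_mono)
      fix i assume i: "i \<in> S"
      then have "cmod (ls ! i) \<le> 1 - m" using gap[of i] by (auto simp: S_def)
      then have "cmod (ls ! i) * g i x \<le> (1 - m) * g i x"
        by (intro mult_right_mono g0)
      then show "g i (A *v x) \<le> (1 - m) * g i x + m / 8 * g (Suc i) x"
        using g_upper[of i x] i by (simp add: S_def)
    qed
    also have "\<dots> = (1 - m) * s x + (\<Sum>i\<in>S. m / 8 * g (Suc i) x)"
      unfolding sum.distrib s_def sum_distrib_left ..
    finally show ?thesis
      using shift[OF sub(1), of x] by linarith
  qed
  have u_A: "(1 + m) * u x - m / 8 * (u x + s x) \<le> u (A *v x)" for x
  proof -
    have "(1 + m) * u x - (\<Sum>i\<in>U. m / 8 * g (Suc i) x)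
        = (\<Sum>i\<in>U. (1 + m) * g i x - m / 8 * g (Suc i) x)"
      unfolding sum_subtractf u_def sum_distrib_left ..
    also have "\<dots> \<le> u (A *v x)"
      unfolding u_def
    proof (rule sum_mono)
      fix i assume i: "i \<in> U"
      then have "1 + m \<le> cmod (ls ! i)" using gap[of i] by (auto simp: U_def)
      then have "(1 + m) * g i x \<le> cmod (ls ! i) * g i x"
        by (intro mult_right_mono g0)
      then show "(1 + m) * g i x - m / 8 * g (Suc i) x \<le> g i (A *v x)"
        using g_lower[of i x] i by (simp add: U_def)
    qed
    finally show ?thesis
      using shift[OF sub(2), of x] by linarith
  qed
  have lower: "norm x \<le> u x + s x" for x
  proof (cases "n = 0")
    case True
    then have "norm x = 0"
      using Y_n[of x] norm_complexify[of x] by (simp add: Y_def)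
    then show ?thesis by (simp add: us True)
  next
    case False
    \<comment> \<open>The summand at index 0 has weight 1 and is already the full norm.\<close>
    have "norm x = g 0 x" by (simp add: g_def Y_def norm_complexify)
    also have "\<dots> \<le> (\<Sum>i<n. g i x)"
      using False g0 by (intro member_le_sum) auto
    finally show ?thesis by (simp add: us)
  qed
  have "\<exists>k. \<forall>x. norm (Y i x) \<le> k * norm x" for i
    using linear_bounded[OF Y_linear] by blast
  then obtain k where k: "\<And>i x. norm (Y i x) \<le> k i * norm x" by metis
  define K where "K = max 1 (\<Sum>i<n. t ^ i * k i)"
  have upper: "u x + s x \<le> K * norm x" for x
  proof -
    have "u x + s x \<le> (\<Sum>i<n. t ^ i * (k i * norm x))"
      unfolding us g_def using t k by (intro sum_mono mult_left_mono) auto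
    also have "\<dots> = (\<Sum>i<n. t ^ i * k i) * norm x"
      by (simp add: sum_distrib_right mult.assoc)
    also have "\<dots> \<le> K * norm x"
      by (intro mult_right_mono) (auto simp: K_def)
    finally show ?thesis .
  qed
  show ?thesis
  proof (rule that[of m K s u])
    show "0 < K" by (simp add: K_def)
    show "0 \<le> s x" "0 \<le> u x" for x
      unfolding s_def u_def by (intro sum_nonneg g0)+
    show "s (x + y) \<le> s x + s y" "u (x + y) \<le> u x + u y" for x y
      unfolding s_def u_def sum.distrib[symmetric] by (intro sum_mono g_add)+
  qed (fact m lower upper u_A s_A)+
qed

section \<open>Convergence rate of orbits and the conclusion\<close>

text \<open>Near 0 the linearisation error adds at most \<open>m / 8 * (u + s)\<close> to the equal
  coupling error of the linear part; together they give the \<open>m / 4\<close> of the cone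
  recursion.\<close>

lemma hyperbolic_orbit_exponential:
  fixes F :: "real^'n \<Rightarrow> real^'n"
  assumes diff: "F differentiable (at 0)"
    and hyp: "hyperbolic_fixed_point F 0"
    and orbit: "\<And>n. X (Suc n) = F (X n)" and lim: "X \<longlonglongrightarrow> 0"
  obtains C r where "0 < r" "r < 1" "\<And>n. norm (X n) \<le> C * r ^ n"
proof -
  define A where "A = jacobian F (at 0)"
  have F0: "F 0 = 0" and ev: "\<And>z. complex_eigenvalue A z \<Longrightarrow> cmod z \<noteq> 1"
    using hyp by (auto simp: hyperbolic_fixed_point_def A_def)
  show thesis
  proof (rule hyperbolic_matrix_seminorms[OF ev])
    fix m K and s u :: "real^'n \<Rightarrow> real"
    assume mK: "0 < m" "m \<le> 1" "0 < K"
      and nonneg: "\<And>x. 0 \<le> s x" "\<And>x. 0 \<le> u x"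
      and tri: "\<And>x y. s (x + y) \<le> s x + s y" "\<And>x y. u (x + y) \<le> u x + u y"
      and bounds: "\<And>x. norm x \<le> u x + s x" "\<And>x. u x + s x \<le> K * norm x"
      and u_A: "\<And>x. (1 + m) * u x - m / 8 * (u x + s x) \<le> u (A *v x)"
      and s_A: "\<And>x. s (A *v x) \<le> (1 - m) * s x + m / 8 * (u x + s x)"
    have "(F has_derivative (\<lambda>h. A *v h)) (at 0)"
      using diff jacobian_works[of F "at 0"] by (simp add: A_def)
    \<comment> \<open>The divisor \<open>K\<close> compensates for measuring the error by
      \<open>u + s\<close>, which is at most \<open>K\<close> times the norm.\<close>
    then obtain d where d: "d > 0" "\<And>y. norm y < d \<Longrightarrow> norm (F y - A *v y) \<le> m / (8 * K) * norm y"
      using mK F0 by (auto simp: has_derivative_at_alt dest!: spec[of _ "m / (8 * K)"])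
    obtain N where N: "\<And>n. n \<ge> N \<Longrightarrow> norm (X n) < d"
      using LIMSEQ_D[OF lim d(1)] by auto
    have err: "K * norm (F (X n) - A *v X n) \<le> m / 8 * (u (X n) + s (X n))" if "n \<ge> N" for n
    proof -
      have "K * norm (F (X n) - A *v X n) \<le> K * (m / (8 * K) * norm (X n))"
        using d(2)[OF N[OF that]] mK by (intro mult_left_mono) auto
      also have "\<dots> = m / 8 * norm (X n)" using mK by simp
      also have "\<dots> \<le> m / 8 * (u (X n) + s (X n))"
        using mK bounds by (intro mult_left_mono) auto
      finally show ?thesis .
    qed
    have "(\<lambda>n. K * norm (X n)) \<longlonglongrightarrow> 0"
      using lim by (auto intro!: tendsto_eq_intros)
    then have u_lim: "(\<lambda>n. u (X n)) \<longlonglongrightarrow> 0"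
    proof (rule tendsto_sandwich[OF _ _ tendsto_const, rotated 2])
      show "\<forall>\<^sub>F n in sequentially. u (X n) \<le> K * norm (X n)"
      proof (intro always_eventually allI)
        show "u (X n) \<le> K * norm (X n)" for n
          using bounds(2)[of "X n"] nonneg(1)[of "X n"] by linarith
      qed
    qed (use nonneg in auto)
    have "\<exists>C. \<forall>n. u (X n) + s (X n) \<le> C * (1 - m / 2) ^ n"
    proof (rule cone_recursion_imp_exponential[where N = N, OF mK(1,2) nonneg u_lim])
      fix n assume n: "n \<ge> N"
      \<comment> \<open>Subadditivity is applied to this splitting of \<open>A *v X n\<close> to
        bound \<open>u (F (X n))\<close> from below.\<close>
      have "A *v X n = F (X n) + (A *v X n - F (X n))" by simp
      then have "u (A *v X n) \<le> u (F (X n)) + u (A *v X n - F (X n))" using tri(2) by metis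
      moreover have "u (A *v X n - F (X n)) \<le> m / 8 * (u (X n) + s (X n))"
        using err[OF n] bounds(2)[of "A *v X n - F (X n)"] nonneg(1)[of "A *v X n - F (X n)"]
        by (simp add: norm_minus_commute)
      ultimately show "(1 + m) * u (X n) - m / 4 * (u (X n) + s (X n)) \<le> u (X (Suc n))"
        using u_A[of "X n"] by (simp add: orbit)
      have "s (F (X n)) \<le> s (A *v X n) + s (F (X n) - A *v X n)"
        using tri(1)[of "A *v X n" "F (X n) - A *v X n"] by simp
      moreover have "s (F (X n) - A *v X n) \<le> m / 8 * (u (X n) + s (X n))"
        using err[OF n] bounds(2)[of "F (X n) - A *v X n"] nonneg(2)[of "F (X n) - A *v X n"]
        by simp
      ultimately show "s (X (Suc n)) \<le> (1 - m) * s (X n) + m / 4 * (u (X n) + s (X n))"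
        using s_A[of "X n"] by (simp add: orbit)
    qed
    then obtain C where "\<And>n. u (X n) + s (X n) \<le> C * (1 - m / 2) ^ n" by blast
    then have "norm (X n) \<le> C * (1 - m / 2) ^ n" for n
      using bounds(1) order_trans by blast
    then show ?thesis
      using mK by (intro that[of "1 - m / 2" C]) auto
  qed
qed

theorem theorem10:
  fixes F :: "real^'n \<Rightarrow> real^'n"
    and r :: nat
    and U :: "(real^'n) set"
    and X :: "nat \<Rightarrow> real^'n"
  assumes "r \<ge> 1"
    and "open U" and "0 \<in> U" and "C_class_on r U F"
    and "F 0 = 0"
    and "\<And>n. X (Suc n) = F (X n)"
    and "X \<longlonglongrightarrow> 0"
    and "\<exists>k d. has_proj_box_dim k (range X) d \<and> d > 0"
  shows "nonhyperbolic_fixed_point F 0"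
proof (rule ccontr)
  assume "\<not> nonhyperbolic_fixed_point F 0"
  then have hyp: "hyperbolic_fixed_point F 0"
    using assms(5) by (simp add: nonhyperbolic_fixed_point_def)
  \<comment> \<open>As \<open>r \<ge> 1\<close>, the successor clause of \<open>C_class_on\<close>
    applies and gives differentiability at each point of \<open>U\<close>.\<close>
  have "F differentiable (at 0)"
    using assms(1,3,4) by (cases r) auto
  then obtain C q where q: "0 < q" "q < 1" and X: "\<And>n. norm (X n) \<le> C * q ^ n"
    using hyperbolic_orbit_exponential[OF _ hyp assms(6,7)] by blast
  obtain k d where d: "has_proj_box_dim k (range X) d" "d > 0"
    using assms(8) by blast
  have "norm (axis_proj k (X n)) \<le> C * q ^ n" for n
    using X[of n] component_le_norm_cart[of "X n" k] by (simp add: axis_proj_def norm_eq_sqrt_inner inner_axis_axis)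
  then have "upper_box_dim (range (\<lambda>n. axis_proj k (X n))) = 0"
    by (rule exponential_imp_upper_box_dim_0[OF q])
  then show False
    using d by (simp add: has_proj_box_dim_def has_box_dim_def image_image)
qed

end
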